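(* Consider the SUM cost on an $s$–$t$ graph $G$ whose $s$–$t$ paths are pairwise disjoint, with $n\ge1$ agents and $k\ge1$ interceptors. Let $\alpha>0$. Then $$\min_{\sigma\in(\Delta(P_{st}))^n}F_n(\sigma,\alpha)=\min_{\sigma\in\mathcal{U}_n}F_n(\sigma,\alpha).$$ Hence $r(G,n,k,\alpha)=r_U(G,n,k,\alpha)$.
   Context: Graph: $G=(V,E,s,t)$ is a finite directed acyclic multigraph ($E$ is a multiset) with source $s$ and sink $t\neq s$, such that $E\ne\emptyset$ and every edge lies on some directed $s$–$t$ path. $P_{st}=\{p_1,\dots,p_m\}$ is the set of directed $s$–$t$ paths; a path is treated as a set of edges and $|p|$ is its number of edges. Here the paths are assumed pairwise disjoint (as edge sets) and indexed so that $|p_1|\le\dots\le|p_m|$; $P_i=\{p_1,\dots,p_i\}$. Strategies: each of the $n$ agents picks a path, giving $a=(a_1,\dots,a_n)\in(P_{st})^n$, with $\bigcup a=\bigcup_i a_i\subseteq E$; the $k$ interceptors pick $d=(d_1,\dots,d_k)\in E^k$. $\Delta X$ is the set of probability distributions on $X$. An element $\sigma=(\sigma_1,\dots,\sigma_n)\in(\Delta(P_{st}))^n$ is identified with the product distribution on $(P_{st})^n$ (uncorrelated agents); correlated agents use arbitrary $\sigma\in\Delta((P_{st})^n)$. SUM cost: $C(a,d,\alpha)=\left|\bigcup a\right|+\alpha\sum_{j\le k}\mathbf 1\{d_j\in\bigcup a\}$. For a distribution $\sigma$ on $(P_{st})^n$, $F_n(\sigma,\alpha)=\max_{d\in E^k}\mathbb{E}_{a\sim\sigma}[C(a,d,\alpha)]$.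 Uniform strategies (for disjoint paths): $\mathcal{U}_n=\{U_{P_i}^n: 1\le i\le m\}$, where $U_{P}$ is the uniform distribution on $P$ and $U_P^n$ is the product of $n$ copies of it. Price of uncorrelation and uniform price of uncorrelation: $$r(G,n,k,\alpha)=\frac{\min_{\sigma\in(\Delta(P_{st}))^n}F_n(\sigma,\alpha)}{\min_{\sigma\in\Delta((P_{st})^n)}F_n(\sigma,\alpha)},\qquad r_U(G,n,k,\alpha)=\frac{\min_{\sigma\in\mathcal{U}_n}F_n(\sigma,\alpha)}{\min_{\sigma\in\mathcal{U}_1}F_1(\sigma,\alpha)}.$$ *)

theory Defs
  imports
    "Graph_Theory.Arc_Walk"
    "HOL-Library.Disjoint_Sets"
    "HOL-Probability.Product_PMF"
begin

section \<open>Source-sink graphs and their paths\<close>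

text \<open>
  Arcs of a \<^typ>\<open>('v, 'e) pre_digraph\<close> are abstract objects with a tail and a head, so parallel
  edges are distinct elements of the arc set and cardinalities count them with multiplicity.
  On an acyclic graph a path is determined by its set of arcs.
\<close>

definition st_paths :: "('v, 'e) pre_digraph \<Rightarrow> 'v \<Rightarrow> 'v \<Rightarrow> 'e set set" where
  "st_paths G s t = {set p | p. pre_digraph.apath G s p t}"

locale st_graph = fin_digraph G
  for G :: "('v, 'e) pre_digraph" (structure) +
  fixes s t :: 'v
  assumes acyclic: "\<nexists>p. cycle p"
    and source_in_verts: "s \<in> verts G"
    and sink_in_verts: "t \<in> verts G"
    and source_neq_sink: "s \<noteq> t"
    and arcs_nonempty: "arcs G \<noteq> {}"
    and arc_on_st_path: "e \<in> arcs G \<Longrightarrow> \<exists>p \<in> st_paths G s t. e \<in> p"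


section \<open>Strategies\<close>

text \<open>
  Agents and interceptors are numbered from 0. A pure profile of \<open>n\<close> agents is an element of the
  extensional function space \<open>{..<n} \<rightarrow>\<^sub>E st_paths G s t\<close>; correspondingly \<^const>\<open>Pi_pmf\<close> is used with
  default value \<^const>\<open>undefined\<close>.
\<close>

definition distributions :: "'a set \<Rightarrow> 'a pmf set" where
  "distributions X = {\<sigma>. set_pmf \<sigma> \<subseteq> X}"

definition correlated ::
    "('v, 'e) pre_digraph \<Rightarrow> 'v \<Rightarrow> 'v \<Rightarrow> nat \<Rightarrow> (nat \<Rightarrow> 'e set) pmf set" where
  "correlated G s t n = distributions ({..<n} \<rightarrow>\<^sub>E st_paths G s t)"

definition uncorrelated ::
    "('v, 'e) pre_digraph \<Rightarrow> 'v \<Rightarrow> 'v \<Rightarrow> nat \<Rightarrow> (nat \<Rightarrow> 'e set) pmf set" where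
  "uncorrelated G s t n =
     {Pi_pmf {..<n} undefined \<sigma> | \<sigma>. \<forall>i<n. \<sigma> i \<in> distributions (st_paths G s t)}"

text \<open>
  The list \<open>ps\<close> is the chosen enumeration \<open>p\<^sub>1, \<dots>, p\<^sub>m\<close> of the paths, and \<open>set (take i ps)\<close> is
  the set \<open>P\<^sub>i\<close> of its first \<open>i\<close> entries.
\<close>

definition uniform_strategies :: "'e set list \<Rightarrow> nat \<Rightarrow> (nat \<Rightarrow> 'e set) pmf set" where
  "uniform_strategies ps n =
     {Pi_pmf {..<n} undefined (\<lambda>_. pmf_of_set (set (take i ps))) | i. 1 \<le> i \<and> i \<le> length ps}"


section \<open>SUM cost and price of uncorrelation\<close>

definition used_arcs :: "nat \<Rightarrow> (nat \<Rightarrow> 'e set) \<Rightarrow> 'e set" where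
  "used_arcs n a = (\<Union>i<n. a i)"

definition sum_cost ::
    "nat \<Rightarrow> nat \<Rightarrow> (nat \<Rightarrow> 'e set) \<Rightarrow> (nat \<Rightarrow> 'e) \<Rightarrow> real \<Rightarrow> real" where
  "sum_cost n k a d \<alpha> =
     real (card (used_arcs n a)) + \<alpha> * (\<Sum>j<k. of_bool (d j \<in> used_arcs n a))"

definition worst_cost ::
    "('v, 'e) pre_digraph \<Rightarrow> nat \<Rightarrow> nat \<Rightarrow> real \<Rightarrow> (nat \<Rightarrow> 'e set) pmf \<Rightarrow> real" where
  "worst_cost G n k \<alpha> \<sigma> =
     Max ((\<lambda>d. measure_pmf.expectation \<sigma> (\<lambda>a. sum_cost n k a d \<alpha>)) ` ({..<k} \<rightarrow>\<^sub>E arcs G))"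

text \<open>
  The sets of mixed strategies are infinite in general, so \<^const>\<open>Min\<close> is not applicable. The value
  below is the minimum whenever it is attained, and unspecified otherwise.
\<close>

definition min_value :: "('a \<Rightarrow> real) \<Rightarrow> 'a set \<Rightarrow> real" where
  "min_value f S = (LEAST v. v \<in> f ` S)"

definition price_of_uncorrelation ::
    "('v, 'e) pre_digraph \<Rightarrow> 'v \<Rightarrow> 'v \<Rightarrow> nat \<Rightarrow> nat \<Rightarrow> real \<Rightarrow> real" where
  "price_of_uncorrelation G s t n k \<alpha> =
     min_value (worst_cost G n k \<alpha>) (uncorrelated G s t n) /
     min_value (worst_cost G n k \<alpha>) (correlated G s t n)"

definition uniform_price_of_uncorrelation ::
    "('v, 'e) pre_digraph \<Rightarrow> 'e set list \<Rightarrow> nat \<Rightarrow> nat \<Rightarrow> real \<Rightarrow> real" where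
  "uniform_price_of_uncorrelation G ps n k \<alpha> =
     min_value (worst_cost G n k \<alpha>) (uniform_strategies ps n) /
     min_value (worst_cost G 1 k \<alpha>) (uniform_strategies ps 1)"

end

theory Submission
  imports Defs
begin

text \<open>
  With disjoint paths, the cost of a mixed profile depends only on the probabilities \<open>q\<^sub>p\<close> that
  path \<open>p\<close> is used: it is \<open>\<Sum>\<^sub>p \<bar>p\<bar> q\<^sub>p + \<alpha> k max\<^sub>p q\<^sub>p\<close>. For independent agents with average
  marginal \<open>x\<close>, AM-GM gives \<open>q\<^sub>p \<ge> g (x\<^sub>p)\<close> where \<open>g x = 1 - (1 - x)\<^sup>n\<close>. Every distribution \<open>x\<close> is
  a convex combination of uniform distributions on sets of paths (its superlevel sets) in such a
  way that \<open>max x\<close> is the same convex combination of their maxima. As \<open>g\<close> is concave, the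
  cost is therefore at least that of some uniform distribution on a set of paths, and replacing
  this set by equally many shortest paths does not increase the cost. For correlated agents
  only \<open>\<Sum>\<^sub>p q\<^sub>p \<ge> 1\<close> is needed; after scaling, the case \<open>n = 1\<close> applies, and the
  bound is attained when all agents follow a common random path.
\<close>

section \<open>Concave costs on the simplex\<close>

text \<open>Induction on the size of the support: subtracting the smallest positive value on the
  whole support removes at least one point and produces one layer. The last conjunct says that some
  point lies in every layer of positive weight, so the total weight is the maximum of
  \<open>x\<close>.\<close>

lemma layer_decomposition:
  fixes x :: "'a \<Rightarrow> real"
  assumes "finite P" "P \<noteq> {}" "\<And>p. p \<in> P \<Longrightarrow> 0 \<le> x p"
  shows "\<exists>\<mu>. (\<forall>S. 0 \<le> \<mu> S) \<and>
           (\<forall>p\<in>P. x p = (\<Sum>S\<in>Pow P - {{}}. \<mu> S * of_bool (p \<in> S))) \<and>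
           (\<exists>p\<in>P. x p = (\<Sum>S\<in>Pow P - {{}}. \<mu> S))"
  using assms(3)
proof (induction "card {p\<in>P. x p \<noteq> 0}" arbitrary: x rule: less_induct)
  case less
  define T where "T = {p\<in>P. x p \<noteq> 0}"
  have T: "finite T" "T \<subseteq> P" using assms(1) by (auto simp: T_def)
  show ?case
  proof (cases "T = {}")
    case True
    then show ?thesis
      using assms(2) by (intro exI[of _ "\<lambda>_. 0"]) (auto simp: T_def)
  next
    case False
    define m where "m = Min (x ` T)"
    have "m \<in> x ` T" unfolding m_def using T False by (intro Min_in) auto
    then obtain p0 where p0: "p0 \<in> T" "x p0 = m" by auto
    have m_le: "m \<le> x p" if "p \<in> T" for p
      unfolding m_def using T that by (intro Min_le) auto
    have m_pos: "0 < m" using p0 less.prems[of p0] by (auto simp: T_def)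
    define y where "y p = x p - m * of_bool (p \<in> T)" for p
    have "{p\<in>P. y p \<noteq> 0} \<subseteq> T - {p0}" using p0 by (auto simp: y_def T_def)
    then have "card {p\<in>P. y p \<noteq> 0} < card T"
      using p0(1) T(1) by (intro psubset_card_mono) auto
    moreover have "0 \<le> y p" if "p \<in> P" for p
      using m_le less.prems that by (auto simp: y_def)
    ultimately obtain \<mu> where \<mu>: "\<And>S. 0 \<le> \<mu> S"
        "\<And>p. p \<in> P \<Longrightarrow> y p = (\<Sum>S\<in>Pow P - {{}}. \<mu> S * of_bool (p \<in> S))"
        "\<exists>p\<in>P. y p = (\<Sum>S\<in>Pow P - {{}}. \<mu> S)"
      using less.hyps[of y] unfolding T_def by blast
    then obtain q' where q': "q' \<in> P" "y q' = (\<Sum>S\<in>Pow P - {{}}. \<mu> S)" by blast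
    \<comment> \<open>The new layer \<open>T\<close> must contain the witness. If \<open>q'\<close>
      lies outside \<open>T\<close>, then the total weight is \<open>y q' = 0\<close>, and
      \<open>p0\<close> serves instead.\<close>
    have "y p0 = 0" using p0 by (simp add: y_def)
    moreover have "y q' = 0" if "q' \<notin> T" using that q' by (simp add: y_def T_def)
    ultimately obtain q where q_mem: "q \<in> T" and q: "q \<in> P" "y q = (\<Sum>S\<in>Pow P - {{}}. \<mu> S)"
      using p0(1) q' T(2) by (metis subsetD)
    define \<nu> where "\<nu> S = \<mu> S + m * of_bool (S = T)" for S
    have T_mem: "T \<in> Pow P - {{}}" using T False by auto
    have sum_T: "(\<Sum>S\<in>Pow P - {{}}. m * of_bool (S = T) * f S) = m * f T" for f
    proof -
      have "(\<Sum>S\<in>Pow P - {{}}. m * of_bool (S = T) * f S) =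
            (\<Sum>S\<in>Pow P - {{}}. if S = T then m * f S else 0)"
        by (intro sum.cong) auto
      then show ?thesis using T_mem assms(1) by (simp add: sum.delta)
    qed
    have "x p = (\<Sum>S\<in>Pow P - {{}}. \<nu> S * of_bool (p \<in> S))" if "p \<in> P" for p
      using \<mu>(2)[OF that] sum_T[of "\<lambda>S. of_bool (p \<in> S)"]
      by (simp add: \<nu>_def y_def distrib_right sum.distrib)
    moreover have "x q = (\<Sum>S\<in>Pow P - {{}}. \<nu> S)"
      using q sum_T[of "\<lambda>_. 1"] q_mem by (simp add: \<nu>_def y_def sum.distrib)
    moreover have "0 \<le> \<nu> S" for S using \<mu>(1) m_pos by (simp add: \<nu>_def)
    ultimately show ?thesis using q by blast
  qed
qed


text \<open>By Jensen, the cost of \<open>x\<close> is at least the \<open>w\<close>-average of the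
  costs of uniform distributions on the layers of \<open>x\<close>, each of which is at least
  \<open>v\<close>. The point \<open>q\<close> is where \<open>x\<close> is largest.\<close>

lemma concave_cost_ge:
  fixes x c :: "'a \<Rightarrow> real"
  assumes "finite P" "\<And>p. p \<in> P \<Longrightarrow> 0 \<le> x p" "sum x P = 1"
    and g: "concave_on {0..1} g" "g 0 = 0"
    and c: "\<And>p. p \<in> P \<Longrightarrow> 0 \<le> c p" and A: "0 \<le> A"
    and v: "\<And>S. S \<subseteq> P \<Longrightarrow> S \<noteq> {} \<Longrightarrow> v \<le> (sum c S + A) * g (1 / real (card S))"
  shows "\<exists>q\<in>P. v \<le> (\<Sum>p\<in>P. c p * g (x p)) + A * g (x q)"
proof -
  have "P \<noteq> {}" using assms(3) by auto
  define D where "D = Pow P - {{}}"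
  have D: "finite D" "D \<noteq> {}" "\<And>S. S \<in> D \<Longrightarrow> 0 < card S" "\<And>S. S \<in> D \<Longrightarrow> S \<subseteq> P"
    using assms(1) \<open>P \<noteq> {}\<close> by (auto simp: D_def card_gt_0_iff dest: finite_subset)
  obtain \<mu> q where \<mu>: "\<And>S. 0 \<le> \<mu> S"
      "\<And>p. p \<in> P \<Longrightarrow> x p = (\<Sum>S\<in>D. \<mu> S * of_bool (p \<in> S))"
      and q: "q \<in> P" "x q = sum \<mu> D"
    using layer_decomposition[OF assms(1) \<open>P \<noteq> {}\<close>, of x] assms(2) unfolding D_def by blast
  \<comment> \<open>The factor \<open>card S\<close> turns layers into uniform distributions:
    \<open>x\<close> is the \<open>w\<close>-average of the densities
    \<open>of_bool (p \<in> S) / card S\<close>, and \<open>w\<close> sums to 1.\<close>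
  define w where "w S = real (card S) * \<mu> S" for S
  have w_nonneg: "0 \<le> w S" for S using \<mu>(1) by (simp add: w_def)
  have sum_of_bool: "(\<Sum>p\<in>P. f p * of_bool (p \<in> S)) = sum f S" if "S \<in> D" for S and f :: "'a \<Rightarrow> real"
  proof -
    have "(\<Sum>p\<in>P. f p * of_bool (p \<in> S)) = (\<Sum>p\<in>P. if p \<in> S then f p else 0)"
      by (intro sum.cong) auto
    also have "\<dots> = sum f (P \<inter> S)" using assms(1) by (simp add: sum.inter_restrict)
    also have "P \<inter> S = S" using D(4)[OF that] by auto
    finally show ?thesis .
  qed
  have "1 = (\<Sum>p\<in>P. \<Sum>S\<in>D. \<mu> S * of_bool (p \<in> S))"
    using assms(3) \<mu>(2) by simp
  also have "\<dots> = (\<Sum>S\<in>D. \<Sum>p\<in>P. \<mu> S * of_bool (p \<in> S))" by (rule sum.swap)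
  also have "\<dots> = sum w D"
    by (intro sum.cong refl) (subst sum_of_bool, auto simp: w_def)
  finally have w_sum: "sum w D = 1" by simp
  have jensen: "(\<Sum>S\<in>D. w S * g (y S)) \<le> g (\<Sum>S\<in>D. w S * y S)"
    if "\<And>S. S \<in> D \<Longrightarrow> y S \<in> {0..1}" for y
    using concave_on_sum[OF D(1,2) g(1) w_sum, of y] w_nonneg that by simp
  have g_x: "(\<Sum>S\<in>D. w S * (of_bool (p \<in> S) * g (1 / real (card S)))) \<le> g (x p)"
    if "p \<in> P" for p
  proof -
    have "x p = (\<Sum>S\<in>D. w S * (of_bool (p \<in> S) / real (card S)))"
      unfolding \<mu>(2)[OF that] using D(3) by (intro sum.cong refl) (force simp: w_def)
    \<comment> \<open>Since \<open>g 0 = 0\<close>, the indicator may be moved inside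
      \<open>g\<close>.\<close>
    moreover have "(\<Sum>S\<in>D. w S * (of_bool (p \<in> S) * g (1 / real (card S)))) =
        (\<Sum>S\<in>D. w S * g (of_bool (p \<in> S) / real (card S)))"
      using g(2) by (intro sum.cong) auto
    ultimately show ?thesis
      using jensen[of "\<lambda>S. of_bool (p \<in> S) / real (card S)"] D(3)
      by (auto simp: field_simps Suc_leI)
  qed
  \<comment> \<open>At \<open>q\<close> the whole weight is collected, so no indicator
    appears.\<close>
  have g_q: "(\<Sum>S\<in>D. w S * g (1 / real (card S))) \<le> g (x q)"
  proof -
    have "x q = (\<Sum>S\<in>D. w S * (1 / real (card S)))"
      unfolding q(2) using D(3) by (intro sum.cong refl) (force simp: w_def)
    then show ?thesis
      using jensen[of "\<lambda>S. 1 / real (card S)"] D(3) by (auto simp: field_simps Suc_leI)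
  qed
  have "v = (\<Sum>S\<in>D. w S * v)" using w_sum by (simp flip: sum_distrib_right)
  also have "\<dots> \<le> (\<Sum>S\<in>D. w S * ((sum c S + A) * g (1 / real (card S))))"
    using v w_nonneg by (intro sum_mono mult_left_mono) (auto simp: D_def)
  also have "\<dots> = (\<Sum>S\<in>D. (\<Sum>p\<in>P. c p * (w S * (of_bool (p \<in> S) * g (1 / real (card S)))))
      + A * (w S * g (1 / real (card S))))"
  proof (intro sum.cong refl)
    fix S assume S: "S \<in> D"
    have "(\<Sum>p\<in>P. c p * (w S * (of_bool (p \<in> S) * g (1 / real (card S))))) =
          sum c S * (w S * g (1 / real (card S)))"
      unfolding sum_of_bool[OF S, of c, symmetric] sum_distrib_right
      by (intro sum.cong) auto
    then show "w S * ((sum c S + A) * g (1 / real (card S))) =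
        (\<Sum>p\<in>P. c p * (w S * (of_bool (p \<in> S) * g (1 / real (card S)))))
        + A * (w S * g (1 / real (card S)))"
      by (simp add: algebra_simps)
  qed
  also have "\<dots> = (\<Sum>p\<in>P. c p * (\<Sum>S\<in>D. w S * (of_bool (p \<in> S) * g (1 / real (card S)))))
      + A * (\<Sum>S\<in>D. w S * g (1 / real (card S)))"
    unfolding sum.distrib sum_distrib_left by (subst sum.swap) (rule refl)
  also have "\<dots> \<le> (\<Sum>p\<in>P. c p * g (x p)) + A * g (x q)"
    using g_x g_q c A by (intro add_mono sum_mono mult_left_mono) auto
  finally show ?thesis using q(1) by blast
qed

section \<open>Elementary inequalities\<close>

text \<open>Exchange argument: the prefix \<open>T\<close> and \<open>S\<close> have equal size, so
  \<open>T - S\<close> and \<open>S - T\<close> do too, and the largest value on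
  \<open>T - S\<close> separates the values on the two differences.\<close>

lemma sum_take_sorted_le:
  fixes f :: "'a \<Rightarrow> nat"
  assumes "distinct xs" "sorted (map f xs)" "S \<subseteq> set xs"
  shows "sum f (set (take (card S) xs)) \<le> sum f S"
proof -
  define T where "T = set (take (card S) xs)"
  have fin: "finite S" "finite T" using assms(3) finite_subset by (auto simp: T_def)
  have "card S \<le> length xs"
    using assms(1,3) card_mono[OF _ assms(3)] distinct_card by fastforce
  then have "card T = card S"
    using assms(1) by (simp add: T_def distinct_card)
  then have card_eq: "card (S - T) = card (T - S)"
    using fin by (simp add: card_Diff_subset_Int Int_commute)
  have le: "f p \<le> f q" if p: "p \<in> T" and q: "q \<in> S - T" for p q
  proof -
    have "sorted (map f (take (card S) xs) @ map f (drop (card S) xs))"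
      using assms(2) by (metis append_take_drop_id map_append)
    moreover have "q \<in> set (drop (card S) xs)"
      using q assms(3) set_append append_take_drop_id[of "card S" xs] unfolding T_def
      by (metis DiffD1 DiffD2 UnE subsetD)
    ultimately show ?thesis using p unfolding T_def by (auto simp: sorted_append)
  qed
  have "sum f (T - S) \<le> sum f (S - T)"
  proof (cases "T - S = {}")
    case True
    show ?thesis unfolding True by simp
  next
    case False
    define w where "w = Max (f ` (T - S))"
    have "w \<in> f ` (T - S)" unfolding w_def using False fin by (intro Max_in) auto
    then have "w \<le> f q" if "q \<in> S - T" for q using le that by auto
    then have "of_nat (card (S - T)) * w \<le> sum f (S - T)" by (intro sum_bounded_below) auto
    moreover have "sum f (T - S) \<le> of_nat (card (T - S)) * w"
      using fin by (intro sum_bounded_above) (auto simp: w_def)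
    ultimately show ?thesis using card_eq by simp
  qed
  then show ?thesis
    using sum.Int_Diff[of S f T] sum.Int_Diff[of T f S] fin
    by (simp add: T_def[symmetric] Int_commute)
qed

text \<open>Convexity of the \<open>n\<close>-th power on the nonnegative reals, composed with the
  affine map from \<open>x\<close> to \<open>1 - x\<close>.\<close>

lemma concave_on_one_minus_power:
  "concave_on {0..1} (\<lambda>x::real. 1 - (1 - x) ^ n)"
proof -
  have pow: "convex_on {0::real..} (\<lambda>x. x ^ n)"
    by (cases "even n") (auto intro: convex_power_odd convex_on_subset[OF convex_power_even])
  show ?thesis
    unfolding concave_on_iff
  proof (intro conjI ballI allI impI)
    fix x y u v :: real
    assume *: "x \<in> {0..1}" "y \<in> {0..1}" "0 \<le> u" "0 \<le> v" "u + v = 1"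
    have "(u * (1 - x) + v * (1 - y)) ^ n \<le> u * (1 - x) ^ n + v * (1 - y) ^ n"
      using pow * unfolding convex_on_def by auto
    moreover have "u * (1 - x) + v * (1 - y) = 1 - (u * x + v * y)"
      using *(5) by (simp add: algebra_simps)
    ultimately show "u * (1 - (1 - x) ^ n) + v * (1 - (1 - y) ^ n) \<le> 1 - (1 - (u *\<^sub>R x + v *\<^sub>R y)) ^ n"
      using *(5) by (simp add: algebra_simps)
  qed simp
qed

text \<open>AM-GM raised to the \<open>n\<close>-th power. It will be applied to the probabilities
  with which the agents avoid a given path.\<close>

lemma prod_le_mean_power:
  fixes y :: "nat \<Rightarrow> real"
  assumes "0 < n" "\<And>i. i < n \<Longrightarrow> 0 \<le> y i"
  shows "(\<Prod>i<n. y i) \<le> ((\<Sum>i<n. y i) / real n) ^ n"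
proof -
  have nonneg: "0 \<le> (\<Prod>i<n. y i)" using assms(2) by (intro prod_nonneg) auto
  have "(\<Prod>i<n. y i) powr (1 / real n) \<le> (\<Sum>i<n. y i) / real n"
    using arith_geom_mean[of "{..<n}" y] assms by (auto simp: sum_divide_distrib)
  then have "((\<Prod>i<n. y i) powr (1 / real n)) ^ n \<le> ((\<Sum>i<n. y i) / real n) ^ n"
    by (intro power_mono) auto
  then show ?thesis using nonneg assms(1) by (simp flip: root_powr_inverse add: powr_realpow)
qed

section \<open>Minimum values and usage probabilities\<close>

lemma is_arg_min_min_value:
  assumes "is_arg_min f (\<lambda>x. x \<in> S) a"
  shows "min_value f S = f a"
  unfolding min_value_def using assms by (intro Least_equality) (auto simp: is_arg_min_linorder)

text \<open>The probability \<open>q\<^sub>p\<close>, defined for any joint distribution so that it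
  covers correlated and independent agents. Entries of a profile from \<open>n\<close> on are
  \<open>undefined\<close>, which might happen to be a path, hence the bound on
  \<open>i\<close>.\<close>

definition usage :: "nat \<Rightarrow> (nat \<Rightarrow> 'e set) pmf \<Rightarrow> 'e set \<Rightarrow> real" where
  "usage n \<sigma> p = measure_pmf.prob \<sigma> {a. \<exists>i<n. a i = p}"

lemma usage_nonneg: "0 \<le> usage n \<sigma> p"
  by (simp add: usage_def)

lemma usage_Pi_pmf:
  "usage n (Pi_pmf {..<n} dflt \<tau>) p = 1 - (\<Prod>i<n. 1 - pmf (\<tau> i) p)"
proof -
  have "{a. \<exists>i<n. a i = p} = UNIV - Pi {..<n} (\<lambda>_. UNIV - {p})" by (auto simp: Pi_def)
  then have "usage n (Pi_pmf {..<n} dflt \<tau>) p =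
      1 - measure_pmf.prob (Pi_pmf {..<n} dflt \<tau>) (Pi {..<n} (\<lambda>_. UNIV - {p}))"
    using measure_pmf.prob_compl[of "Pi {..<n} (\<lambda>_. UNIV - {p})" "Pi_pmf {..<n} dflt \<tau>"]
    by (simp add: usage_def)
  also have "measure_pmf.prob (\<tau> i) (UNIV - {p}) = 1 - pmf (\<tau> i) p" for i
    using measure_pmf.prob_compl[of "{p}" "\<tau> i"] by (simp add: measure_pmf_single)
  then have "measure_pmf.prob (Pi_pmf {..<n} dflt \<tau>) (Pi {..<n} (\<lambda>_. UNIV - {p})) =
      (\<Prod>i<n. 1 - pmf (\<tau> i) p)"
    by (simp add: measure_Pi_pmf_Pi)
  finally show ?thesis .
qed

lemma Pi_pmf_in_distributions:
  fixes n :: nat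
  assumes "\<And>i. i < n \<Longrightarrow> \<tau> i \<in> distributions X"
  shows "Pi_pmf {..<n} undefined \<tau> \<in> distributions ({..<n} \<rightarrow>\<^sub>E X)"
  using assms by (auto simp: distributions_def set_Pi_pmf PiE_dflt_def PiE_iff extensional_def)

section \<open>Cost formula for disjoint paths\<close>

text \<open>Vertices are forgotten: what remains is a partition of the arcs into finite nonempty
  blocks, listed by size.\<close>

locale disjoint_paths =
  fixes G :: "('v, 'e) pre_digraph" and ps :: "'e set list"
  assumes arcs_eq: "arcs G = \<Union>(set ps)"
    and ps_nonempty: "ps \<noteq> []"
    and finite_path: "p \<in> set ps \<Longrightarrow> finite p"
    and path_nonempty: "p \<in> set ps \<Longrightarrow> p \<noteq> {}"
    and paths_disjoint: "disjoint (set ps)"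
    and distinct_paths: "distinct ps"
    and sorted_paths: "sorted (map card ps)"
begin

lemma path_unique: "p \<in> set ps \<Longrightarrow> q \<in> set ps \<Longrightarrow> e \<in> p \<Longrightarrow> e \<in> q \<Longrightarrow> p = q"
  using paths_disjoint unfolding disjoint_def by blast

text \<open>Here \<open>f j\<close> is the path hit by interceptor \<open>j\<close>. By disjointness
  its arc is used exactly when that path is, and the number of used arcs is the total length of the
  used paths; linearity of expectation does the rest.\<close>

lemma expected_sum_cost:
  assumes \<sigma>: "\<sigma> \<in> distributions ({..<n} \<rightarrow>\<^sub>E set ps)"
    and f: "\<And>j. j < k \<Longrightarrow> f j \<in> set ps \<and> d j \<in> f j"
  shows "measure_pmf.expectation \<sigma> (\<lambda>a. sum_cost n k a d \<alpha>) =
    (\<Sum>p\<in>set ps. real (card p) * usage n \<sigma> p) + \<alpha> * (\<Sum>j<k. usage n \<sigma> (f j))"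
proof -
  have fin: "finite (set_pmf \<sigma>)"
    using \<sigma> finite_subset[OF _ finite_PiE[of "{..<n}" "\<lambda>_. set ps"]]
    by (auto simp: distributions_def)
  have usage_eq: "measure_pmf.expectation \<sigma> (\<lambda>a. of_bool (\<exists>i<n. a i = p)) = usage n \<sigma> p" for p
  proof -
    have "(\<lambda>a. of_bool (\<exists>i<n. a i = p)) = (indicator {a. \<exists>i<n. a i = p} :: _ \<Rightarrow> real)"
      by (auto simp: indicator_def)
    then show ?thesis by (simp add: usage_def)
  qed
  note integrable = integrable_measure_pmf_finite[OF fin]
  have "sum_cost n k a d \<alpha> =
      (\<Sum>p\<in>set ps. real (card p) * of_bool (\<exists>i<n. a i = p)) + \<alpha> * (\<Sum>j<k. of_bool (\<exists>i<n. a i = f j))"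
    if "a \<in> set_pmf \<sigma>" for a
  proof -
    have a: "a i \<in> set ps" if "i < n" for i
      using \<sigma> \<open>a \<in> set_pmf \<sigma>\<close> that by (auto simp: distributions_def)
    have "d j \<in> used_arcs n a \<longleftrightarrow> (\<exists>i<n. a i = f j)" if "j < k" for j
      using f[OF that] a path_unique unfolding used_arcs_def by blast
    moreover have "card (used_arcs n a) = (\<Sum>p\<in>set ps. card p * of_bool (\<exists>i<n. a i = p))"
    proof -
      \<comment> \<open>Summing over the image counts a path shared by several agents only
        once.\<close>
      have sub: "a ` {..<n} \<subseteq> set ps" using a by auto
      have "card (used_arcs n a) = sum card (a ` {..<n})"
        unfolding used_arcs_def
        using paths_disjoint sub finite_path
        by (intro card_Union_disjoint) (auto simp: disjoint_def pairwise_def disjnt_def)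
      also have "\<dots> = (\<Sum>p\<in>set ps. card p * of_bool (\<exists>i<n. a i = p))"
        using sub by (intro sum.mono_neutral_cong_left) auto
      finally show ?thesis .
    qed
    ultimately show ?thesis by (simp add: sum_cost_def)
  qed
  \<comment> \<open>The rewriting is valid on the support only, so the integrands agree almost
    everywhere.\<close>
  then have "measure_pmf.expectation \<sigma> (\<lambda>a. sum_cost n k a d \<alpha>) =
      measure_pmf.expectation \<sigma> (\<lambda>a. (\<Sum>p\<in>set ps. real (card p) * of_bool (\<exists>i<n. a i = p))
        + \<alpha> * (\<Sum>j<k. of_bool (\<exists>i<n. a i = f j)))"
    by (intro integral_cong_AE) (auto simp: AE_measure_pmf_iff)
  also have "\<dots> = (\<Sum>p\<in>set ps. real (card p) * measure_pmf.expectation \<sigma> (\<lambda>a. of_bool (\<exists>i<n. a i = p)))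
        + \<alpha> * (\<Sum>j<k. measure_pmf.expectation \<sigma> (\<lambda>a. of_bool (\<exists>i<n. a i = f j)))"
    by (simp only: Bochner_Integration.integral_add[OF integrable integrable]
        Bochner_Integration.integral_sum[OF integrable] integral_mult_right_zero)
  finally show ?thesis unfolding usage_eq .
qed

text \<open>Each interceptor hits with probability at most the largest usage, and all of them reach
  it by attacking one and the same arc of a most used path.\<close>

lemma worst_cost_eq:
  assumes \<sigma>: "\<sigma> \<in> distributions ({..<n} \<rightarrow>\<^sub>E set ps)" and "0 < \<alpha>"
  shows "worst_cost G n k \<alpha> \<sigma> =
    (\<Sum>p\<in>set ps. real (card p) * usage n \<sigma> p) + \<alpha> * real k * Max (usage n \<sigma> ` set ps)"
  unfolding worst_cost_def
proof (rule Max_eqI)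
  have "finite (arcs G)" using arcs_eq finite_path by auto
  then show "finite ((\<lambda>d. measure_pmf.expectation \<sigma> (\<lambda>a. sum_cost n k a d \<alpha>)) ` ({..<k} \<rightarrow>\<^sub>E arcs G))"
    by (intro finite_imageI finite_PiE) auto
next
  fix y assume "y \<in> (\<lambda>d. measure_pmf.expectation \<sigma> (\<lambda>a. sum_cost n k a d \<alpha>)) ` ({..<k} \<rightarrow>\<^sub>E arcs G)"
  then obtain d where d: "d \<in> {..<k} \<rightarrow>\<^sub>E arcs G"
    and y: "y = measure_pmf.expectation \<sigma> (\<lambda>a. sum_cost n k a d \<alpha>)" by blast
  have "\<exists>p. p \<in> set ps \<and> d j \<in> p" if "j < k" for j using d that arcs_eq by blast
  then obtain f where f: "\<And>j. j < k \<Longrightarrow> f j \<in> set ps \<and> d j \<in> f j" by metis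
  have "(\<Sum>j<k. usage n \<sigma> (f j)) \<le> of_nat (card {..<k}) * Max (usage n \<sigma> ` set ps)"
    using f by (intro sum_bounded_above) auto
  then show "y \<le> (\<Sum>p\<in>set ps. real (card p) * usage n \<sigma> p) + \<alpha> * real k * Max (usage n \<sigma> ` set ps)"
    using \<open>0 < \<alpha>\<close> unfolding y
    by (subst expected_sum_cost[OF \<sigma>, where f = f]) (use f in auto)
next
  have "Max (usage n \<sigma> ` set ps) \<in> usage n \<sigma> ` set ps" using ps_nonempty by (intro Max_in) auto
  then obtain p where p: "p \<in> set ps" "Max (usage n \<sigma> ` set ps) = usage n \<sigma> p" by auto
  obtain e where e: "e \<in> p" using path_nonempty p(1) by blast
  show "(\<Sum>p\<in>set ps. real (card p) * usage n \<sigma> p) + \<alpha> * real k * Max (usage n \<sigma> ` set ps)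
      \<in> (\<lambda>d. measure_pmf.expectation \<sigma> (\<lambda>a. sum_cost n k a d \<alpha>)) ` ({..<k} \<rightarrow>\<^sub>E arcs G)"
  proof (rule image_eqI)
    show "(\<lambda>j\<in>{..<k}. e) \<in> {..<k} \<rightarrow>\<^sub>E arcs G" using e p(1) arcs_eq by auto
    show "(\<Sum>p\<in>set ps. real (card p) * usage n \<sigma> p) + \<alpha> * real k * Max (usage n \<sigma> ` set ps) =
        measure_pmf.expectation \<sigma> (\<lambda>a. sum_cost n k a (\<lambda>j\<in>{..<k}. e) \<alpha>)"
      using e p by (subst expected_sum_cost[OF \<sigma>, where f = "\<lambda>_. p"]) auto
  qed
qed

section \<open>Lower bounds by the best uniform strategy\<close>

text \<open>Worst cost when \<open>n\<close> agents draw independently and uniformly from the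
  \<open>i\<close> shortest paths, with \<open>A\<close> in place of \<open>\<alpha> * k\<close>.
  The last factor is the usage of each of these paths.\<close>

definition uniform_cost :: "nat \<Rightarrow> real \<Rightarrow> nat \<Rightarrow> real" where
  "uniform_cost n A i =
     ((\<Sum>p\<in>set (take i ps). real (card p)) + A) * (1 - (1 - 1 / real i) ^ n)"

definition best_uniform_cost :: "nat \<Rightarrow> real \<Rightarrow> real" where
  "best_uniform_cost n A = Min (uniform_cost n A ` {1..length ps})"

lemma best_uniform_cost_attained:
  obtains i where "1 \<le> i" "i \<le> length ps" "best_uniform_cost n A = uniform_cost n A i"
proof -
  have "best_uniform_cost n A \<in> uniform_cost n A ` {1..length ps}"
    unfolding best_uniform_cost_def using ps_nonempty by (intro Min_in) (auto simp: Suc_le_eq)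
  then show thesis using that by auto
qed

lemma best_uniform_cost_le:
  "1 \<le> i \<Longrightarrow> i \<le> length ps \<Longrightarrow> best_uniform_cost n A \<le> uniform_cost n A i"
  unfolding best_uniform_cost_def by (intro Min_le) auto

text \<open>Exchanging \<open>S\<close> for equally many shortest paths lowers the total length; the
  other factor is nonnegative and depends only on \<open>card S\<close>.\<close>

lemma best_uniform_cost_le_set:
  assumes "S \<subseteq> set ps" "S \<noteq> {}"
  shows "best_uniform_cost n A \<le>
    ((\<Sum>p\<in>S. real (card p)) + A) * (1 - (1 - 1 / real (card S)) ^ n)"
proof -
  have S: "1 \<le> card S" "card S \<le> length ps"
    using assms card_mono[OF _ assms(1)] distinct_card[OF distinct_paths] finite_subset
    by (auto simp: Suc_le_eq card_gt_0_iff)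
  have "real (sum card (set (take (card S) ps))) \<le> real (sum card S)"
    using sum_take_sorted_le[OF distinct_paths sorted_paths assms(1)] by (simp only: of_nat_le_iff)
  moreover have "(1 - 1 / real (card S)) ^ n \<le> 1"
    using S by (intro power_le_one) (auto simp: field_simps)
  ultimately have "uniform_cost n A (card S) \<le>
      ((\<Sum>p\<in>S. real (card p)) + A) * (1 - (1 - 1 / real (card S)) ^ n)"
    unfolding uniform_cost_def by (intro mult_right_mono) auto
  then show ?thesis using best_uniform_cost_le[OF S, of n A] by linarith
qed

text \<open>Here \<open>x\<close> is the common marginal of \<open>n\<close> independent agents. For
  \<open>n = 1\<close> the bound is linear in \<open>x\<close>, the form needed for correlated
  agents.\<close>

lemma best_uniform_cost_le_simplex:
  assumes "\<And>p. p \<in> set ps \<Longrightarrow> 0 \<le> x p" "sum x (set ps) = 1" "0 \<le> A" "0 < n"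
  shows "\<exists>q\<in>set ps. best_uniform_cost n A \<le>
    (\<Sum>p\<in>set ps. real (card p) * (1 - (1 - x p) ^ n)) + A * (1 - (1 - x q) ^ n)"
  using assms concave_on_one_minus_power best_uniform_cost_le_set
  by (intro concave_cost_ge[where g = "\<lambda>x. 1 - (1 - x) ^ n"]) auto

text \<open>Giving every agent the average marginal \<open>x\<close> does not increase any usage
  probability, by AM-GM, so the bound for identical agents applies.\<close>

lemma worst_cost_uncorrelated_ge:
  assumes \<tau>: "\<And>i. i < n \<Longrightarrow> \<tau> i \<in> distributions (set ps)" and "0 < n" "0 < \<alpha>"
  shows "best_uniform_cost n (\<alpha> * real k) \<le> worst_cost G n k \<alpha> (Pi_pmf {..<n} undefined \<tau>)"
proof -
  define u where "u = usage n (Pi_pmf {..<n} undefined \<tau>)"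
  define x where "x p = (\<Sum>i<n. pmf (\<tau> i) p) / real n" for p
  have "sum x (set ps) = (\<Sum>i<n. \<Sum>p\<in>set ps. pmf (\<tau> i) p) / real n"
    unfolding x_def sum_divide_distrib[symmetric] by (subst sum.swap) (rule refl)
  also have "\<dots> = 1"
    using \<tau> \<open>0 < n\<close> by (simp add: sum_pmf_eq_1 distributions_def)
  finally have sum_x: "sum x (set ps) = 1" .
  have u: "1 - (1 - x p) ^ n \<le> u p" for p
  proof -
    have "(\<Sum>i<n. 1 - pmf (\<tau> i) p) / real n = 1 - x p"
      using \<open>0 < n\<close> by (simp add: x_def sum_subtractf diff_divide_distrib)
    then show ?thesis
      using prod_le_mean_power[OF \<open>0 < n\<close>, of "\<lambda>i. 1 - pmf (\<tau> i) p"]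
      by (simp add: u_def usage_Pi_pmf pmf_le_1)
  qed
  obtain q where q: "q \<in> set ps" "best_uniform_cost n (\<alpha> * real k) \<le>
      (\<Sum>p\<in>set ps. real (card p) * (1 - (1 - x p) ^ n)) + \<alpha> * real k * (1 - (1 - x q) ^ n)"
    using best_uniform_cost_le_simplex[OF _ sum_x, of "\<alpha> * real k" n] \<open>0 < n\<close> \<open>0 < \<alpha>\<close>
    by (auto simp: x_def sum_nonneg)
  note q(2)
  also have "\<dots> \<le> (\<Sum>p\<in>set ps. real (card p) * u p) + \<alpha> * real k * Max (u ` set ps)"
  proof (intro add_mono sum_mono mult_left_mono u)
    show "1 - (1 - x q) ^ n \<le> Max (u ` set ps)"
      using u[of q] q(1) by (intro order_trans[OF _ Max_ge]) auto
  qed (use \<open>0 < \<alpha>\<close> in auto)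
  also have "\<dots> = worst_cost G n k \<alpha> (Pi_pmf {..<n} undefined \<tau>)"
    unfolding u_def using \<tau> \<open>0 < \<alpha>\<close> by (intro worst_cost_eq[symmetric] Pi_pmf_in_distributions)
  finally show ?thesis .
qed

text \<open>Union bound: as there is at least one agent, some path is always used.\<close>

lemma sum_usage_ge_1:
  assumes \<sigma>: "\<sigma> \<in> distributions ({..<n} \<rightarrow>\<^sub>E set ps)" and "0 < n"
  shows "1 \<le> sum (usage n \<sigma>) (set ps)"
proof -
  have "measure_pmf.prob \<sigma> (\<Union>p\<in>set ps. {a. \<exists>i<n. a i = p}) = 1"
    using \<sigma> \<open>0 < n\<close>
    by (subst measure_pmf.prob_eq_1) (auto simp: AE_measure_pmf_iff distributions_def)
  moreover have "measure_pmf.prob \<sigma> (\<Union>p\<in>set ps. {a. \<exists>i<n. a i = p}) \<le> sum (usage n \<sigma>) (set ps)"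
    unfolding usage_def by (intro measure_pmf.finite_measure_subadditive_finite) auto
  ultimately show ?thesis by simp
qed

text \<open>Dividing the usages by their sum \<open>z \<ge> 1\<close> gives a distribution lying
  below them, to which the case \<open>n = 1\<close> applies.\<close>

lemma worst_cost_correlated_ge:
  assumes \<sigma>: "\<sigma> \<in> distributions ({..<n} \<rightarrow>\<^sub>E set ps)" and "0 < n" "0 < \<alpha>"
  shows "best_uniform_cost 1 (\<alpha> * real k) \<le> worst_cost G n k \<alpha> \<sigma>"
proof -
  define u where "u = usage n \<sigma>"
  define z where "z = sum u (set ps)"
  have z: "1 \<le> z" unfolding z_def u_def by (rule sum_usage_ge_1[OF \<sigma> \<open>0 < n\<close>])
  have u_nonneg: "0 \<le> u p" for p by (simp add: u_def usage_nonneg)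
  have u: "u p / z \<le> u p" for p using z u_nonneg[of p] by (simp add: divide_le_eq mult_le_cancel_left1)
  have "sum (\<lambda>p. u p / z) (set ps) = 1" using z by (simp add: z_def flip: sum_divide_distrib)
  then obtain q where q: "q \<in> set ps" "best_uniform_cost 1 (\<alpha> * real k) \<le>
      (\<Sum>p\<in>set ps. real (card p) * (u p / z)) + \<alpha> * real k * (u q / z)"
    using best_uniform_cost_le_simplex[of "\<lambda>p. u p / z" "\<alpha> * real k" 1] z u_nonneg \<open>0 < \<alpha>\<close> by auto
  note q(2)
  also have "\<dots> \<le> (\<Sum>p\<in>set ps. real (card p) * u p) + \<alpha> * real k * Max (u ` set ps)"
  proof (intro add_mono sum_mono mult_left_mono u)
    show "u q / z \<le> Max (u ` set ps)"
      using u[of q] q(1) by (intro order_trans[OF _ Max_ge]) auto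
  qed (use \<open>0 < \<alpha>\<close> in auto)
  also have "\<dots> = worst_cost G n k \<alpha> \<sigma>"
    unfolding u_def using \<sigma> \<open>0 < \<alpha>\<close> by (intro worst_cost_eq[symmetric])
  finally show ?thesis .
qed

section \<open>Strategies attaining the bounds\<close>

text \<open>Evaluates both optimal strategies: independent uniform draws and a common random path
  each use all paths of a prefix equally often and no others.\<close>

lemma worst_cost_const_usage:
  assumes \<sigma>: "\<sigma> \<in> distributions ({..<n} \<rightarrow>\<^sub>E set ps)" and "0 < \<alpha>" "0 \<le> h"
    and i: "1 \<le> i" "i \<le> length ps"
    and usage: "\<And>p. p \<in> set ps \<Longrightarrow> usage n \<sigma> p = h * of_bool (p \<in> set (take i ps))"
  shows "worst_cost G n k \<alpha> \<sigma> = ((\<Sum>p\<in>set (take i ps). real (card p)) + \<alpha> * real k) * h"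
proof -
  \<comment> \<open>The first path belongs to every nonempty prefix and witnesses that the maximum
    \<open>h\<close> is attained.\<close>
  have "hd ps \<in> set (take i ps)" using i ps_nonempty by (cases ps; cases i) auto
  then have "Max (usage n \<sigma> ` set ps) = h"
    using usage \<open>0 \<le> h\<close> ps_nonempty by (intro Max_eqI) (auto intro!: image_eqI[of _ _ "hd ps"])
  moreover have "(\<Sum>p\<in>set ps. real (card p) * usage n \<sigma> p) = (\<Sum>p\<in>set (take i ps). real (card p) * h)"
    using usage set_take_subset[of i ps] by (intro sum.mono_neutral_cong_right) auto
  ultimately show ?thesis
    unfolding worst_cost_eq[OF \<sigma> \<open>0 < \<alpha>\<close>] by (simp add: distrib_right sum_distrib_right)
qed

lemma pmf_of_prefix:
  assumes "1 \<le> i" "i \<le> length ps"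
  shows "pmf (pmf_of_set (set (take i ps))) p = 1 / real i * of_bool (p \<in> set (take i ps))"
    and "pmf_of_set (set (take i ps)) \<in> distributions (set ps)"
proof -
  have "set (take i ps) \<noteq> {}" using assms ps_nonempty by auto
  moreover have "card (set (take i ps)) = i" using assms distinct_paths by (simp add: distinct_card)
  ultimately show "pmf (pmf_of_set (set (take i ps))) p = 1 / real i * of_bool (p \<in> set (take i ps))"
    and "pmf_of_set (set (take i ps)) \<in> distributions (set ps)"
    using set_take_subset[of i ps] by (auto simp: distributions_def pmf_of_set)
qed

lemma worst_cost_uniform:
  assumes "1 \<le> i" "i \<le> length ps" "0 < \<alpha>" "0 < n"
  shows "worst_cost G n k \<alpha> (Pi_pmf {..<n} undefined (\<lambda>_. pmf_of_set (set (take i ps)))) =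
    uniform_cost n (\<alpha> * real k) i"
  unfolding uniform_cost_def
proof (intro worst_cost_const_usage Pi_pmf_in_distributions pmf_of_prefix assms)
  show "0 \<le> 1 - (1 - 1 / real i) ^ n"
    using assms(1) by (simp add: power_le_one)
  show "usage n (Pi_pmf {..<n} undefined (\<lambda>_. pmf_of_set (set (take i ps)))) p =
      (1 - (1 - 1 / real i) ^ n) * of_bool (p \<in> set (take i ps))" for p
    using assms by (simp add: usage_Pi_pmf pmf_of_prefix)
qed

text \<open>When all agents copy one random path, its usage is just the probability of drawing it,
  so the cost is that of a single agent.\<close>

lemma worst_cost_common_path:
  fixes \<sigma> :: "(nat \<Rightarrow> 'e set) pmf"
  assumes "1 \<le> i" "i \<le> length ps" "0 < \<alpha>" "0 < n"
  defines "\<sigma> \<equiv> map_pmf (\<lambda>p. \<lambda>j\<in>{..<n}. p) (pmf_of_set (set (take i ps)))"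
  shows "\<sigma> \<in> distributions ({..<n} \<rightarrow>\<^sub>E set ps)"
    and "worst_cost G n k \<alpha> \<sigma> = uniform_cost 1 (\<alpha> * real k) i"
proof -
  show \<sigma>: "\<sigma> \<in> distributions ({..<n} \<rightarrow>\<^sub>E set ps)"
    using pmf_of_prefix(2)[OF assms(1,2)] by (auto simp: \<sigma>_def distributions_def)
  have "usage n \<sigma> p = 1 / real i * of_bool (p \<in> set (take i ps))" for p
  proof -
    have "(\<lambda>p. \<lambda>j\<in>{..<n}. p) -` {a. \<exists>j<n. a j = p} = {p}" using \<open>0 < n\<close> by auto
    then show ?thesis
      by (simp add: usage_def \<sigma>_def measure_map_pmf measure_pmf_single pmf_of_prefix(1)[OF assms(1,2)])
  qed
  then show "worst_cost G n k \<alpha> \<sigma> = uniform_cost 1 (\<alpha> * real k) i"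
    using worst_cost_const_usage[OF \<sigma> \<open>0 < \<alpha>\<close> _ assms(1,2), of "1 / real i"]
    by (simp add: uniform_cost_def)
qed

text \<open>Needed for \<open>n\<close> agents and again for one agent, in the denominator of the
  uniform price.\<close>

lemma uniform_arg_min:
  assumes "0 < n" "0 < \<alpha>"
  obtains \<sigma> where "\<sigma> \<in> uniform_strategies ps n"
    "is_arg_min (worst_cost G n k \<alpha>) (\<lambda>\<sigma>. \<sigma> \<in> uniform_strategies ps n) \<sigma>"
    "worst_cost G n k \<alpha> \<sigma> = best_uniform_cost n (\<alpha> * real k)"
proof -
  obtain i where i: "1 \<le> i" "i \<le> length ps"
      "best_uniform_cost n (\<alpha> * real k) = uniform_cost n (\<alpha> * real k) i"
    by (rule best_uniform_cost_attained)
  let ?\<sigma> = "Pi_pmf {..<n} undefined (\<lambda>_. pmf_of_set (set (take i ps)))"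
  have "?\<sigma> \<in> uniform_strategies ps n" using i by (auto simp: uniform_strategies_def)
  moreover have "worst_cost G n k \<alpha> ?\<sigma> = best_uniform_cost n (\<alpha> * real k)"
    using i assms by (simp add: worst_cost_uniform)
  moreover have "best_uniform_cost n (\<alpha> * real k) \<le> worst_cost G n k \<alpha> \<tau>"
    if "\<tau> \<in> uniform_strategies ps n" for \<tau>
    using that assms by (auto simp: uniform_strategies_def worst_cost_uniform best_uniform_cost_le)
  ultimately show thesis by (intro that[of ?\<sigma>]) (auto simp: is_arg_min_linorder)
qed

end

section \<open>Application to source-sink graphs\<close>

text \<open>The paths cover the arcs because every arc lies on one, and none is empty because an
  empty walk cannot join distinct vertices.\<close>

lemma (in st_graph) disjoint_paths_st_paths:
  assumes "disjoint (st_paths G s t)" "set ps = st_paths G s t" "distinct ps" "sorted (map card ps)"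
  shows "disjoint_paths G ps"
proof
  show "arcs G = \<Union>(set ps)"
    using arc_on_st_path assms(2) by (auto simp: st_paths_def apath_def awalk_def)
  show "ps \<noteq> []" using arc_on_st_path arcs_nonempty assms(2) by fastforce
  show "finite p" if "p \<in> set ps" for p using that assms(2) by (auto simp: st_paths_def)
  show "p \<noteq> {}" if "p \<in> set ps" for p
    using that assms(2) source_neq_sink by (auto simp: st_paths_def apath_Nil_iff)
qed (use assms in auto)

theorem theorem10:
  fixes G :: "('v, 'e) pre_digraph" and s t :: 'v
    and ps :: "'e set list" and n k :: nat and \<alpha> :: real
  assumes "st_graph G s t"
    and "disjoint (st_paths G s t)"
    and "set ps = st_paths G s t" and "distinct ps" and "sorted (map card ps)"
    and "n \<ge> 1" and "k \<ge> 1" and "\<alpha> > 0"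
  shows "(\<exists>\<sigma>. is_arg_min (worst_cost G n k \<alpha>) (\<lambda>\<sigma>. \<sigma> \<in> uncorrelated G s t n) \<sigma>) \<and>
         (\<exists>\<sigma>. is_arg_min (worst_cost G n k \<alpha>) (\<lambda>\<sigma>. \<sigma> \<in> correlated G s t n) \<sigma>) \<and>
         min_value (worst_cost G n k \<alpha>) (uncorrelated G s t n) =
           min_value (worst_cost G n k \<alpha>) (uniform_strategies ps n) \<and>
         price_of_uncorrelation G s t n k \<alpha> = uniform_price_of_uncorrelation G ps n k \<alpha>"
proof -
  interpret disjoint_paths G ps
    using st_graph.disjoint_paths_st_paths[OF assms(1-5)] .
  let ?A = "\<alpha> * real k"
  have n: "0 < n" using assms(6) by simp
  obtain \<sigma> where \<sigma>: "\<sigma> \<in> uniform_strategies ps n"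
      "is_arg_min (worst_cost G n k \<alpha>) (\<lambda>\<sigma>. \<sigma> \<in> uniform_strategies ps n) \<sigma>"
      "worst_cost G n k \<alpha> \<sigma> = best_uniform_cost n ?A"
    using uniform_arg_min[OF n assms(8)] .
  \<comment> \<open>The best uniform strategy is itself uncorrelated and meets the lower bound, so
    it is optimal in the larger set.\<close>
  have "\<sigma> \<in> uncorrelated G s t n"
    using \<sigma>(1) pmf_of_prefix(2) assms(3) unfolding uniform_strategies_def uncorrelated_def by fastforce
  moreover have "best_uniform_cost n ?A \<le> worst_cost G n k \<alpha> \<tau>"
    if "\<tau> \<in> uncorrelated G s t n" for \<tau>
    using that worst_cost_uncorrelated_ge[OF _ n assms(8)] assms(3) by (auto simp: uncorrelated_def)
  ultimately have unc: "is_arg_min (worst_cost G n k \<alpha>) (\<lambda>\<sigma>. \<sigma> \<in> uncorrelated G s t n) \<sigma>"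
    using \<sigma>(3) by (auto simp: is_arg_min_linorder)
  obtain \<sigma>1 where \<sigma>1:
      "is_arg_min (worst_cost G 1 k \<alpha>) (\<lambda>\<sigma>. \<sigma> \<in> uniform_strategies ps 1) \<sigma>1"
      "worst_cost G 1 k \<alpha> \<sigma>1 = best_uniform_cost 1 ?A"
    using uniform_arg_min[OF zero_less_one assms(8)] .
  obtain i where i: "1 \<le> i" "i \<le> length ps" "best_uniform_cost 1 ?A = uniform_cost 1 ?A i"
    by (rule best_uniform_cost_attained)
  obtain \<rho> where \<rho>: "\<rho> \<in> correlated G s t n" "worst_cost G n k \<alpha> \<rho> = best_uniform_cost 1 ?A"
    using worst_cost_common_path[OF i(1,2) assms(8) n] i(3) assms(3) by (auto simp: correlated_def)
  moreover have "best_uniform_cost 1 ?A \<le> worst_cost G n k \<alpha> \<tau>"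
    if "\<tau> \<in> correlated G s t n" for \<tau>
    using that worst_cost_correlated_ge[OF _ n assms(8)] assms(3) by (auto simp: correlated_def)
  ultimately have cor: "is_arg_min (worst_cost G n k \<alpha>) (\<lambda>\<sigma>. \<sigma> \<in> correlated G s t n) \<rho>"
    by (auto simp: is_arg_min_linorder)
  \<comment> \<open>Both prices are now \<open>best_uniform_cost n ?A\<close> divided by
    \<open>best_uniform_cost 1 ?A\<close>.\<close>
  show ?thesis
    using unc cor is_arg_min_min_value[OF unc] is_arg_min_min_value[OF cor]
      is_arg_min_min_value[OF \<sigma>(2)] is_arg_min_min_value[OF \<sigma>1(1)] \<sigma>(3) \<sigma>1(2) \<rho>(2)
    unfolding price_of_uncorrelation_def uniform_price_of_uncorrelation_def by auto
qed

end
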